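(* Let $F:2^{[n]}\to\mathbb{R}$ be submodular with $F(\emptyset)=0$ and let $h:\mathbb{R}^n\to\mathbb{R}$ be a smooth concave function. In the algorithm L-FCFW on $(h,F)$, the active sets $\mathcal{B}^{(i)}$ can be chosen (together with the multipliers $\lambda$) to satisfy $|\mathcal{B}^{(i)}|\le n+1$ at every iteration $i$.
   Context: $[n]=\{1,\dots,n\}$. $F$ is submodular if $F(A)+F(B)\ge F(A\cup B)+F(A\cap B)$ for all $A,B\subseteq[n]$. With $w(A)=\sum_{k\in A}w_k$, the base polytope is $B(F)=\{w\in\mathbb{R}^n: w(A)\le F(A)\ \forall A\subseteq[n],\ w([n])=F([n])\}$, with vertex set $\mathrm{vert}(B(F))$. Algorithm L-FCFW (Limited Memory Fully Corrective Frank-Wolfe) for maximizing $h$ over $B(F)$ with tolerance $\epsilon\ge0$: choose nonempty $\mathcal{V}^{(0)}\subseteq\mathrm{vert}(B(F))$. For $i=1,2,\dots$: (1) let $w^{(i)}\in\operatorname{argmax}\{h(w): w\in\mathrm{conv}(\mathcal{V}^{(i-1)})\}$ and choose $\lambda_v\ge0$ ($v\in\mathcal{V}^{(i-1)}$) with $\sum_v\lambda_v=1$, $w^{(i)}=\sum_v\lambda_v v$; (2) let $x^{(i)}=\nabla h(w^{(i)})$ and choose a vertex $v^{(i)}\in\mathrm{vert}(B(F))$ maximizing $w^\top x^{(i)}$ over $w\in B(F)$; (3) stop and return $w^{(i)}$ if $(v^{(i)})^\top x^{(i)}-(w^{(i)})^\top x^{(i)}\le\epsilon$; (4) otherwise choose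 any $\mathcal{B}^{(i)}\subseteq\mathrm{vert}(B(F))$ with $\mathcal{B}^{(i)}\supseteq\{w\in\mathcal{V}^{(i-1)}:\lambda_w>0\}$ and put $\mathcal{V}^{(i)}=\mathcal{B}^{(i)}\cup\{v^{(i)}\}$. *)

theory Defs
  imports "HOL-Analysis.Analysis" "HOL-Library.Extended_Nat"
begin

text \<open>The ground set \<open>[n]\<close> is the finite type \<open>'n\<close>, so \<open>n = CARD('n)\<close>.\<close>

definition submodular :: "('n set \<Rightarrow> real) \<Rightarrow> bool" where
  "submodular F \<longleftrightarrow> (\<forall>A B. F A + F B \<ge> F (A \<union> B) + F (A \<inter> B))"

definition base_polytope :: "('n::finite set \<Rightarrow> real) \<Rightarrow> (real ^ 'n) set" where
  "base_polytope F =
     {w. (\<forall>A. (\<Sum>k\<in>A. w $ k) \<le> F A) \<and> (\<Sum>k\<in>UNIV. w $ k) = F UNIV}"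

definition vert :: "(real ^ 'n) set \<Rightarrow> (real ^ 'n) set" where
  "vert P = {v. v extreme_point_of P}"

text \<open>Smoothness is read as continuous differentiability, so it also covers the readings
  ``Lipschitz gradient'' and ``infinitely differentiable''.\<close>

definition smooth :: "(real ^ 'n::finite \<Rightarrow> real) \<Rightarrow> bool" where
  "smooth h \<longleftrightarrow> (\<exists>g. (\<forall>w. GDERIV h w :> g w) \<and> continuous_on UNIV g)"

definition convex_multipliers ::
  "(real ^ 'n) set \<Rightarrow> real ^ 'n \<Rightarrow> (real ^ 'n \<Rightarrow> real) \<Rightarrow> bool" where
  "convex_multipliers V w l \<longleftrightarrow>
     (\<forall>v\<in>V. 0 \<le> l v) \<and> (\<Sum>v\<in>V. l v) = 1 \<and> w = (\<Sum>v\<in>V. l v *\<^sub>R v)"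

definition active_set ::
  "('n::finite set \<Rightarrow> real) \<Rightarrow> (real ^ 'n) set \<Rightarrow> (real ^ 'n \<Rightarrow> real) \<Rightarrow> (real ^ 'n) set \<Rightarrow> bool" where
  "active_set F V l B \<longleftrightarrow> B \<subseteq> vert (base_polytope F) \<and> {v \<in> V. l v > 0} \<subseteq> B"

text \<open>
  A trace records the choices of one execution. The field \<open>iters\<close> is the number of
  iterations entered, possibly \<open>\<infinity>\<close>. Iterations are numbered from \<open>1\<close>, and index \<open>0\<close>
  is meaningful for \<open>Vs\<close> only. Entries beyond \<open>iters\<close> are irrelevant, as are \<open>Bs i\<close>
  and \<open>Vs i\<close> when \<open>i\<close> is the last iteration entered: step (4) is not carried out there.
\<close>

record 'n lfcfw_trace =
  iters :: enat
  Vs :: "nat \<Rightarrow> (real ^ 'n) set"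
  ws :: "nat \<Rightarrow> real ^ 'n"
  lams :: "nat \<Rightarrow> real ^ 'n \<Rightarrow> real"
  xs :: "nat \<Rightarrow> real ^ 'n"
  vs :: "nat \<Rightarrow> real ^ 'n"
  Bs :: "nat \<Rightarrow> (real ^ 'n) set"

definition stop_test :: "real \<Rightarrow> 'n::finite lfcfw_trace \<Rightarrow> nat \<Rightarrow> bool" where
  "stop_test \<epsilon> r i \<longleftrightarrow> vs r i \<bullet> xs r i - ws r i \<bullet> xs r i \<le> \<epsilon>"

text \<open>Executions may be broken off before the stopping test succeeds.\<close>

definition lfcfw_run ::
  "(real ^ 'n::finite \<Rightarrow> real) \<Rightarrow> ('n set \<Rightarrow> real) \<Rightarrow> real \<Rightarrow> 'n lfcfw_trace \<Rightarrow> bool" where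
  "lfcfw_run h F \<epsilon> r \<longleftrightarrow>
     Vs r 0 \<noteq> {} \<and> Vs r 0 \<subseteq> vert (base_polytope F) \<and>
     (\<forall>i\<ge>1. enat i \<le> iters r \<longrightarrow>
        is_arg_max h (\<lambda>w. w \<in> convex hull (Vs r (i - 1))) (ws r i) \<and>
        convex_multipliers (Vs r (i - 1)) (ws r i) (lams r i) \<and>
        GDERIV h (ws r i) :> xs r i \<and>
        vs r i \<in> vert (base_polytope F) \<and>
        is_arg_max (\<lambda>w. w \<bullet> xs r i) (\<lambda>w. w \<in> base_polytope F) (vs r i)) \<and>
     (\<forall>i\<ge>1. enat i < iters r \<longrightarrow>
        \<not> stop_test \<epsilon> r i \<and>
        active_set F (Vs r (i - 1)) (lams r i) (Bs r i) \<and>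
        Vs r i = Bs r i \<union> {vs r i})"

definition lfcfw_complete_run ::
  "(real ^ 'n::finite \<Rightarrow> real) \<Rightarrow> ('n set \<Rightarrow> real) \<Rightarrow> real \<Rightarrow> 'n lfcfw_trace \<Rightarrow> bool" where
  "lfcfw_complete_run h F \<epsilon> r \<longleftrightarrow>
     lfcfw_run h F \<epsilon> r \<and> iters r \<noteq> 0 \<and> (\<forall>k. iters r = enat k \<longrightarrow> stop_test \<epsilon> r k)"

text \<open>
  A rule \<open>(L, A)\<close> for choosing multipliers and active sets: \<open>\<lambda> = L V w\<close> and \<open>B = A V w\<close>
  in an iteration with current vertex set \<open>V\<close> and maximizer \<open>w\<close>. All other choices of
  the algorithm remain free.
\<close>

definition legal_rule ::
  "(real ^ 'n::finite \<Rightarrow> real) \<Rightarrow> ('n set \<Rightarrow> real) \<Rightarrow>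
   ((real ^ 'n) set \<Rightarrow> real ^ 'n \<Rightarrow> (real ^ 'n \<Rightarrow> real)) \<Rightarrow>
   ((real ^ 'n) set \<Rightarrow> real ^ 'n \<Rightarrow> (real ^ 'n) set) \<Rightarrow> bool" where
  "legal_rule h F L A \<longleftrightarrow>
     (\<forall>V w. V \<noteq> {} \<longrightarrow> V \<subseteq> vert (base_polytope F) \<longrightarrow>
        is_arg_max h (\<lambda>u. u \<in> convex hull V) w \<longrightarrow>
        convex_multipliers V w (L V w) \<and> active_set F V (L V w) (A V w))"

definition follows_rule ::
  "((real ^ 'n) set \<Rightarrow> real ^ 'n \<Rightarrow> (real ^ 'n \<Rightarrow> real)) \<Rightarrow>
   ((real ^ 'n) set \<Rightarrow> real ^ 'n \<Rightarrow> (real ^ 'n) set) \<Rightarrow>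
   'n::finite lfcfw_trace \<Rightarrow> bool" where
  "follows_rule L A r \<longleftrightarrow>
     (\<forall>i\<ge>1. enat i \<le> iters r \<longrightarrow> lams r i = L (Vs r (i - 1)) (ws r i)) \<and>
     (\<forall>i\<ge>1. enat i < iters r \<longrightarrow> Bs r i = A (Vs r (i - 1)) (ws r i))"

end

theory Submission
  imports Defs
begin

text \<open>
  By Caratheodory's theorem every point of \<open>conv V\<close> is a convex combination of at most \<open>n + 1\<close>
  elements of \<open>V\<close>. Choose such multipliers and let the active set be exactly their support.
  Complete runs obeying this rule exist because the base polytope is compact with finitely many
  vertices: \<open>h\<close> attains its maximum on each \<open>conv V\<close>, and a linear functional attains its
  maximum over the base polytope at a vertex.
\<close>

lemma inner_indicator_vec:
  fixes w :: "real ^ 'n::finite"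
  shows "(\<chi> k. if k \<in> A then 1 else 0) \<bullet> w = (\<Sum>k\<in>A. w $ k)"
proof -
  have "(\<chi> k. if k \<in> A then 1 else 0) \<bullet> w = (\<Sum>k\<in>UNIV. if k \<in> A then w $ k else 0)"
    by (auto simp: inner_vec_def intro: sum.cong)
  also have "\<dots> = (\<Sum>k\<in>A. w $ k)"
    by (simp add: sum.If_cases)
  finally show ?thesis .
qed

text \<open>Each constraint on \<open>w\<close> is a halfspace, or for the total a hyperplane,
  normal to an indicator vector; there are finitely many because \<open>'n set\<close> is a finite
  type.\<close>

lemma polyhedron_base_polytope:
  fixes F :: "'n::finite set \<Rightarrow> real"
  shows "polyhedron (base_polytope F)"
proof -
  define e :: "'n set \<Rightarrow> real ^ 'n" where "e A = (\<chi> k. if k \<in> A then 1 else 0)" for A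
  have "base_polytope F =
      \<Inter> (range (\<lambda>A. {w. e A \<bullet> w \<le> F A})) \<inter> {w. e UNIV \<bullet> w = F UNIV}"
    unfolding e_def inner_indicator_vec by (auto simp: base_polytope_def)
  moreover have "polyhedron (\<Inter> (range (\<lambda>A. {w. e A \<bullet> w \<le> F A})))"
    by (intro polyhedron_Inter) (auto intro: polyhedron_halfspace_le)
  ultimately show ?thesis
    by (simp add: polyhedron_hyperplane)
qed

text \<open>The singleton constraint bounds a coordinate from above. Subtracting the constraint of
  the complement from the equation for the total bounds it from below.\<close>

lemma bounded_base_polytope:
  fixes F :: "'n::finite set \<Rightarrow> real"
  shows "bounded (base_polytope F)"
proof (rule bounded_subset[OF bounded_cbox])
  show "base_polytope F \<subseteq> cbox (\<chi> k. F UNIV - F (UNIV - {k})) (\<chi> k. F {k})"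
  proof
    fix w assume w: "w \<in> base_polytope F"
    have le: "(\<Sum>k\<in>A. w $ k) \<le> F A" for A
      using w by (simp add: base_polytope_def)
    have "F UNIV - F (UNIV - {k}) \<le> w $ k \<and> w $ k \<le> F {k}" for k
    proof -
      have "F UNIV = w $ k + (\<Sum>j\<in>UNIV - {k}. w $ j)"
        using w sum.remove[of UNIV k "($) w"] by (simp add: base_polytope_def)
      then show ?thesis
        using le[of "{k}"] le[of "UNIV - {k}"] by simp
    qed
    then show "w \<in> cbox (\<chi> k. F UNIV - F (UNIV - {k})) (\<chi> k. F {k})"
      by (simp add: mem_box_cart)
  qed
qed

lemma compact_base_polytope: "compact (base_polytope F)"
  by (simp add: compact_eq_bounded_closed bounded_base_polytope polyhedron_base_polytope
      polyhedron_imp_closed)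

lemma finite_vert_base_polytope: "finite (vert (base_polytope F))"
  unfolding vert_def by (rule finite_polyhedron_extreme_points[OF polyhedron_base_polytope])

text \<open>The maximizers form a nonempty compact convex face, which has an extreme point, and an
  extreme point of a face is extreme in the whole set.\<close>

lemma linear_max_at_extreme_point:
  fixes P :: "'a::euclidean_space set"
  assumes "compact P" "convex P" "P \<noteq> {}"
  obtains v where "v extreme_point_of P" "is_arg_max (\<lambda>w. w \<bullet> x) (\<lambda>w. w \<in> P) v"
proof -
  have "continuous_on P (\<lambda>w. w \<bullet> x)"
    by (intro continuous_intros)
  then obtain m where m: "m \<in> P" "\<And>w. w \<in> P \<Longrightarrow> w \<bullet> x \<le> m \<bullet> x"
    using continuous_attains_sup[OF assms(1,3)] by blast
  let ?Q = "P \<inter> {w. x \<bullet> w = m \<bullet> x}"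
  have face: "?Q face_of P"
    using m by (intro face_of_Int_supporting_hyperplane_le assms) (simp add: inner_commute)
  have "compact ?Q" "convex ?Q"
    by (intro compact_Int_closed closed_hyperplane convex_Int convex_hyperplane assms)+
  moreover have "?Q \<noteq> {}"
    using m by (auto simp: inner_commute)
  ultimately obtain v where v: "v extreme_point_of ?Q"
    using extreme_point_exists_convex by blast
  show thesis
  proof
    show "v extreme_point_of P"
      using v face by (simp add: extreme_point_of_face)
    show "is_arg_max (\<lambda>w. w \<bullet> x) (\<lambda>w. w \<in> P) v"
      using v m by (auto simp: is_arg_max_def extreme_point_of_def inner_commute not_less)
  qed
qed

text \<open>Caratheodory gives a subset \<open>S\<close> of at most n + 1 points; its weights,
  extended by zero to \<open>V\<close>, have their support inside \<open>S\<close>.\<close>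

lemma caratheodory_multipliers:
  fixes V :: "(real ^ 'n::finite) set"
  assumes "finite V" "w \<in> convex hull V"
  obtains l where "convex_multipliers V w l" "card {v \<in> V. l v > 0} \<le> CARD('n) + 1"
proof -
  obtain S where S: "finite S" "S \<subseteq> V" "card S \<le> CARD('n) + 1" "w \<in> convex hull S"
    using assms(2) by (auto simp: caratheodory[of V])
  then obtain u where u: "\<And>v. v \<in> S \<Longrightarrow> 0 \<le> u v" "sum u S = 1" "(\<Sum>v\<in>S. u v *\<^sub>R v) = w"
    by (auto simp: convex_hull_finite)
  let ?l = "\<lambda>v. if v \<in> S then u v else 0"
  show thesis
  proof
    have "sum ?l V = sum u S"
      using assms(1) S by (intro sum.mono_neutral_cong_right) auto
    moreover have "(\<Sum>v\<in>V. ?l v *\<^sub>R v) = (\<Sum>v\<in>S. u v *\<^sub>R v)"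
      using assms(1) S by (intro sum.mono_neutral_cong_right) auto
    ultimately show "convex_multipliers V w ?l"
      using u by (simp add: convex_multipliers_def)
    have "card {v \<in> V. ?l v > 0} \<le> card S"
      using S by (intro card_mono) (auto split: if_splits)
    then show "card {v \<in> V. ?l v > 0} \<le> CARD('n) + 1"
      using S by simp
  qed
qed

lemma smooth_attains_arg_max:
  assumes "smooth h" "compact K" "K \<noteq> {}"
  shows "\<exists>w. is_arg_max h (\<lambda>u. u \<in> K) w"
proof -
  have "continuous_on K h"
    using assms(1) unfolding smooth_def gderiv_def
    by (metis has_derivative_continuous continuous_at_imp_continuous_on)
  then obtain w where "w \<in> K" "\<forall>u\<in>K. h u \<le> h w"
    using continuous_attains_sup[OF assms(2,3)] by blast
  then have "is_arg_max h (\<lambda>u. u \<in> K) w"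
    by (auto simp: is_arg_max_def not_less)
  then show ?thesis ..
qed

text \<open>Fixing a selection for every free choice makes the algorithm deterministic. It is
  iterated forever and then cut at the first iteration that passes the stopping test.\<close>

lemma complete_run_exists:
  fixes F :: "'n::finite set \<Rightarrow> real"
  assumes h: "smooth h" and rule: "legal_rule h F L A"
    and V0: "V0 \<noteq> {}" "V0 \<subseteq> vert (base_polytope F)"
  shows "\<exists>r. lfcfw_complete_run h F \<epsilon> r \<and> follows_rule L A r \<and> Vs r 0 = V0"
proof -
  let ?P = "base_polytope F"
  \<comment> \<open>A vertex in \<open>V0\<close> witnesses that the polytope is nonempty.\<close>
  have P: "compact ?P" "convex ?P" "?P \<noteq> {}"
    using V0 by (auto simp: compact_base_polytope polyhedron_base_polytope polyhedron_imp_convex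
        vert_def extreme_point_of_def)
  obtain g where g: "\<And>w. GDERIV h w :> g w"
    using h by (auto simp: smooth_def)
  have W_ex: "\<exists>w. is_arg_max h (\<lambda>u. u \<in> convex hull V) w" if "V \<noteq> {}" "V \<subseteq> vert ?P" for V
  proof (rule smooth_attains_arg_max[OF h])
    show "compact (convex hull V)"
      using that finite_vert_base_polytope finite_subset
      by (intro finite_imp_compact_convex_hull) blast
  qed (use that in simp)
  define W where "W V = (SOME w. is_arg_max h (\<lambda>u. u \<in> convex hull V) w)" for V
  have W: "is_arg_max h (\<lambda>u. u \<in> convex hull V) (W V)" if "V \<noteq> {}" "V \<subseteq> vert ?P" for V
    unfolding W_def by (rule someI_ex[OF W_ex[OF that]])
  have "\<exists>v. v \<in> vert ?P \<and> is_arg_max (\<lambda>w. w \<bullet> x) (\<lambda>w. w \<in> ?P) v" for x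
    using linear_max_at_extreme_point[OF P, of x] unfolding vert_def by blast
  then obtain v where v: "\<And>x. v x \<in> vert ?P"
      "\<And>x. is_arg_max (\<lambda>w. w \<bullet> x) (\<lambda>w. w \<in> ?P) (v x)"
    by metis
  \<comment> \<open>\<open>VV i\<close> is the vertex set after \<open>i\<close> iterations when the
    stopping test is ignored.\<close>
  define VV where "VV = rec_nat V0 (\<lambda>_ V. A V (W V) \<union> {v (g (W V))})"
  have VV_0: "VV 0 = V0" and VV_Suc: "VV (Suc i) = A (VV i) (W (VV i)) \<union> {v (g (W (VV i)))}" for i
    by (simp_all add: VV_def)
  have legal: "convex_multipliers V (W V) (L V (W V))" "active_set F V (L V (W V)) (A V (W V))"
    if "V \<noteq> {}" "V \<subseteq> vert ?P" for V
    using rule W[OF that] that by (auto simp: legal_rule_def)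
  \<comment> \<open>\<open>rule\<close> speaks only of nonempty sets of vertices, so this invariant
    is carried along; the added vertex keeps the sets nonempty.\<close>
  have VV: "VV i \<noteq> {} \<and> VV i \<subseteq> vert ?P" for i
    by (induction i) (use V0 v legal in \<open>auto simp: VV_0 VV_Suc active_set_def\<close>)
  \<comment> \<open>Iteration \<open>i\<close> works on the set with index \<open>i - 1\<close>. At
    \<open>i = 0\<close> truncated subtraction gives dummy entries, and the conditions on a run read
    only \<open>Vs\<close> there.\<close>
  define r0 :: "'n lfcfw_trace" where
    "r0 = \<lparr>iters = \<infinity>, Vs = VV, ws = (\<lambda>i. W (VV (i - 1))),
      lams = (\<lambda>i. L (VV (i - 1)) (W (VV (i - 1)))), xs = (\<lambda>i. g (W (VV (i - 1)))),
      vs = (\<lambda>i. v (g (W (VV (i - 1))))), Bs = (\<lambda>i. A (VV (i - 1)) (W (VV (i - 1))))\<rparr>"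
  \<comment> \<open>Demanding \<open>i \<ge> 1\<close> keeps the dummy entry at 0 from ending the
    run, which later yields \<open>N \<noteq> 0\<close>.\<close>
  define stops where "stops i \<longleftrightarrow> i \<ge> 1 \<and> stop_test \<epsilon> r0 i" for i
  define N where "N = (if \<exists>i. stops i then enat (LEAST i. stops i) else \<infinity>)"
  define r where "r = r0\<lparr>iters := N\<rparr>"
  have stop_r: "stop_test \<epsilon> r i = stop_test \<epsilon> r0 i" for i
    by (simp add: stop_test_def r_def)
  have N_stop: "stops k" if "N = enat k" for k
    using that LeastI_ex[of stops] by (auto simp: N_def split: if_splits)
  have N_before: "\<not> stop_test \<epsilon> r i" if "i \<ge> 1" "enat i < N" for i
    using that not_less_Least[of i stops]
    by (auto simp: N_def stops_def stop_r split: if_splits)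
  have Vs_step: "VV i = A (VV (i - 1)) (W (VV (i - 1))) \<union> {v (g (W (VV (i - 1))))}" if "i \<ge> 1" for i
    using VV_Suc[of "i - 1"] that by simp
  have "lfcfw_run h F \<epsilon> r"
    unfolding lfcfw_run_def
    using V0 VV W v g legal N_before Vs_step by (simp add: r_def r0_def VV_0)
  moreover have "N \<noteq> 0"
    using N_stop[of 0] by (auto simp: stops_def zero_enat_def)
  ultimately have "lfcfw_complete_run h F \<epsilon> r"
    using N_stop by (auto simp: lfcfw_complete_run_def stops_def stop_r) (simp_all add: r_def)
  moreover have "follows_rule L A r"
    by (simp add: follows_rule_def r_def r0_def)
  moreover have "Vs r 0 = V0"
    by (simp add: r_def r0_def VV_0)
  ultimately show ?thesis by blast
qed

text \<open>For \<open>i > 0\<close> the strict bound says that step (4) was carried out in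
  iteration \<open>i\<close>, so \<open>Vs r i\<close> consists of an active set and the new vertex.
  At the last iteration entered \<open>Vs r i\<close> is unconstrained.\<close>

lemma run_vertex_sets:
  assumes "lfcfw_run h F \<epsilon> r" "enat i < iters r"
  shows "Vs r i \<noteq> {} \<and> Vs r i \<subseteq> vert (base_polytope F)"
proof (cases "i = 0")
  case True
  then show ?thesis using assms by (simp add: lfcfw_run_def)
next
  case False
  then show ?thesis
    using assms by (simp add: lfcfw_run_def active_set_def)
qed

theorem corollary6p2:
  fixes F :: "'n::finite set \<Rightarrow> real"
    and h :: "real ^ 'n \<Rightarrow> real"
    and \<epsilon> :: real
  assumes "submodular F" and "F {} = 0"
    and "concave_on UNIV h" and "smooth h"
    and "\<epsilon> \<ge> 0"
  shows "\<exists>L A. legal_rule h F L A \<and>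
           (\<forall>V\<^sub>0. V\<^sub>0 \<noteq> {} \<longrightarrow> V\<^sub>0 \<subseteq> vert (base_polytope F) \<longrightarrow>
              (\<exists>r. lfcfw_complete_run h F \<epsilon> r \<and> follows_rule L A r \<and> Vs r 0 = V\<^sub>0)) \<and>
           (\<forall>r. lfcfw_run h F \<epsilon> r \<longrightarrow> follows_rule L A r \<longrightarrow>
              (\<forall>i\<ge>1. enat i < iters r \<longrightarrow> finite (Bs r i) \<and> card (Bs r i) \<le> CARD('n) + 1))"
proof -
  let ?good = "\<lambda>(V :: (real ^ 'n) set) w l.
    convex_multipliers V w l \<and> card {v \<in> V. l v > 0} \<le> CARD('n) + 1"
  \<comment> \<open>One small-support choice is fixed for each pair of \<open>V\<close> and
    \<open>w\<close>; it is meaningful when \<open>V\<close> is finite and \<open>w\<close> lies in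
    its hull.\<close>
  define L where "L V w = (SOME l. ?good V w l)" for V w
  have L: "?good V w (L V w)" if "finite V" "w \<in> convex hull V" for V w
  proof -
    have "\<exists>l. ?good V w l"
      using caratheodory_multipliers[OF that] by blast
    then show ?thesis
      unfolding L_def by (rule someI_ex[of "?good V w"])
  qed
  \<comment> \<open>The support itself is the smallest active set allowed, so the bound on the
    support becomes the bound on \<open>Bs\<close>.\<close>
  define A where "A V w = {v \<in> V. L V w v > 0}" for V w
  have fin: "finite V" if "V \<subseteq> vert (base_polytope F)" for V
    using that finite_vert_base_polytope finite_subset by blast
  have rule: "legal_rule h F L A"
    unfolding legal_rule_def
  proof (intro allI impI)
    fix V w
    assume V: "V \<subseteq> vert (base_polytope F)" and w: "is_arg_max h (\<lambda>u. u \<in> convex hull V) w"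
    then have "convex_multipliers V w (L V w)"
      using L[OF fin] by (simp add: is_arg_max_def)
    with V show "convex_multipliers V w (L V w) \<and> active_set F V (L V w) (A V w)"
      by (auto simp: active_set_def A_def)
  qed
  have bound: "finite (Bs r i) \<and> card (Bs r i) \<le> CARD('n) + 1"
    if r: "lfcfw_run h F \<epsilon> r" "follows_rule L A r" and i: "i \<ge> 1" "enat i < iters r" for r i
  proof -
    let ?V = "Vs r (i - 1)"
    \<comment> \<open>The set entering iteration \<open>i\<close> has index \<open>i - 1\<close>,
      still strictly below \<open>iters r\<close>, so it is a set of vertices and hence
      finite.\<close>
    have "enat (i - 1) < iters r"
      using i by (meson diff_le_self enat_ord_simps(1) le_less_trans)
    then have "finite ?V"
      using run_vertex_sets[OF r(1)] by (intro fin) simp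
    moreover have "ws r i \<in> convex hull ?V"
      using r i by (simp add: lfcfw_run_def is_arg_max_def)
    ultimately have "?good ?V (ws r i) (L ?V (ws r i))"
      by (rule L)
    moreover have "Bs r i = A ?V (ws r i)"
      using r i by (simp add: follows_rule_def)
    ultimately show ?thesis
      using \<open>finite ?V\<close> by (simp add: A_def)
  qed
  show ?thesis
  proof (intro exI[of _ L] exI[of _ A] conjI allI impI)
    show "legal_rule h F L A" by (rule rule)
  next
    fix V0 :: "(real ^ 'n) set"
    assume "V0 \<noteq> {}" "V0 \<subseteq> vert (base_polytope F)"
    then show "\<exists>r. lfcfw_complete_run h F \<epsilon> r \<and> follows_rule L A r \<and> Vs r 0 = V0"
      by (rule complete_run_exists[OF \<open>smooth h\<close> rule])
  next
    fix r i
    assume "lfcfw_run h F \<epsilon> r" "follows_rule L A r" "1 \<le> i" "enat i < iters r"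
    note bound[OF this]
    then show "finite (Bs r i)" "card (Bs r i) \<le> CARD('n) + 1"
      by simp_all
  qed
qed

end
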